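(* For every $k\ge0$, $V^k$ is the unique irreducible Hilbert $\mathsf{RP}$-module of weight $k$ up to isomorphism.
   Context: Rectangular planar rook category $\mathsf{RP}$: objects $[n]$, $n\ge0$; $\mathsf{RP}(m,n)$ is the complex vector space spanned by isotopy classes of rectangular diagrams with $m$ marked points on the bottom and $n$ on the top, each marked point being on exactly one string, each string meeting one or two marked points, strings not intersecting, and no string joining two bottom points or two top points. A string joining a bottom and a top point is a through string, one meeting only a bottom point is a cap, and one meeting only a top point is a cup. Diagrams correspond to order-preserving partial injections $\{1,\dots,m\}\rightharpoonup\{1,\dots,n\}$. Composition is stacking, with floating strings removed (composition of partial injections); the adjoint is the conjugate-linear extension of vertical reflection. $\mathsf{RP}_k=\mathsf{RP}(k,k)$; tensor product is horizontal juxtaposition. A Hilbert $\mathsf{RP}$-module is a $\mathbb{C}$-linear $*$-functor $V$ from $\mathsf{RP}$ to finite dimensional complex Hilbert spaces and linear maps, $V_n=V([n])$. It is irreducible if it is nonzero and has no proper nonzero submodules. Its weight is the least $n$ with $V_n\neq(0)$. Definition of $V^k$: let the dotted strand be $d=\mathrm{id}_{[1]}-e\in\mathsf{RP}_1$, where $e$ is the broken strand (one cap and one cup), and let $p_k=d\otimes\cdots\otimes d\in\mathsf{RP}_k$ ($k$ factors). Let $\mathsf{RI}_k\subset\mathsf{RP}_k$ be the ideal spanned by diagrams with fewer than $k$ through strings; it has codimension one. Let $\mathrm{tr}:\mathsf{RP}_k\to\mathbb{C}$ be the linear functional with $\mathrm{tr}(p_k)=1$ and $\mathrm{tr}|_{\mathsf{RI}_k}=0$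 (so $p_k$ has length one and all other minimal projections have length zero). For $a,b\in\mathsf{RP}(k,m)$ let $\langle a,b\rangle=\mathrm{tr}(b^*a)$. $V^k_m$ is the quotient of $\mathsf{RP}(k,m)$ by the radical of this form, with the induced inner product and the action of $\mathsf{RP}(m,n)$ by left composition. *)

theory Defs
  imports Complex_Main "HOL-Algebra.AbelCoset" "Jordan_Normal_Form.VS_Connect"
begin

section \<open>Diagrams and the category RP\<close>

text \<open>
  A rectangular diagram with \<open>m\<close> bottom and \<open>n\<close> top points is encoded by its through strings: an
  order-preserving partial injection from \<open>{1..m}\<close> to \<open>{1..n}\<close>, as a function of type
  \<^typ>\<open>nat \<Rightarrow> nat option\<close>.  Caps are the bottom points outside the domain and cups the top points
  outside the range.  The encoding does not remember \<open>m\<close> and \<open>n\<close>, so the operations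
  below carry them as arguments where they matter.
\<close>

type_synonym diagram = "nat \<rightharpoonup> nat"

definition rp_diag :: "nat \<Rightarrow> nat \<Rightarrow> diagram set" where
  "rp_diag m n = {f. dom f \<subseteq> {1..m} \<and> ran f \<subseteq> {1..n} \<and>
                     inj_on f (dom f) \<and> mono_on (dom f) (\<lambda>i. the (f i))}"

definition dg_id :: "nat \<Rightarrow> diagram" where
  "dg_id n = (\<lambda>i. if i \<in> {1..n} then Some i else None)"

definition dg_flip :: "diagram \<Rightarrow> diagram" where
  "dg_flip f = (\<lambda>j. if j \<in> ran f then Some (THE i. f i = Some j) else None)"

text \<open>Juxtaposition, with the diagram \<open>f\<close> from \<open>[m]\<close> to \<open>[n]\<close> on the left.\<close>

definition dg_tensor :: "nat \<Rightarrow> nat \<Rightarrow> diagram \<Rightarrow> diagram \<Rightarrow> diagram" where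
  "dg_tensor m n f g = (\<lambda>i. if i \<le> m then f i else map_option ((+) n) (g (i - m)))"

text \<open>A morphism is the function giving the coefficient of each diagram.\<close>

type_synonym rp_mor = "diagram \<Rightarrow> complex"

text \<open>
  The fields \<open>mult\<close> and \<open>one\<close> of a module record play no role in the module axioms; they are left
  undefined here and below.
\<close>

definition RP :: "nat \<Rightarrow> nat \<Rightarrow> (complex, rp_mor) module" where
  "RP m n = \<lparr> carrier = {x. \<forall>f. x f \<noteq> 0 \<longrightarrow> f \<in> rp_diag m n},
              mult = undefined, one = undefined,
              zero = (\<lambda>f. 0), add = (\<lambda>x y f. x f + y f),
              smult = (\<lambda>c x f. c * x f) \<rparr>"

definition rp_basis :: "diagram \<Rightarrow> rp_mor" where
  "rp_basis f = (\<lambda>g. if g = f then 1 else 0)"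

definition rp_id :: "nat \<Rightarrow> rp_mor" where
  "rp_id n = rp_basis (dg_id n)"

text \<open>The composite of \<open>x\<close> from \<open>[l]\<close> to \<open>[m]\<close> followed by \<open>y\<close> from \<open>[m]\<close> to \<open>[n]\<close>.\<close>

definition rp_comp :: "nat \<Rightarrow> nat \<Rightarrow> nat \<Rightarrow> rp_mor \<Rightarrow> rp_mor \<Rightarrow> rp_mor" where
  "rp_comp l m n y x =
     (\<lambda>h. \<Sum>f\<in>rp_diag l m. \<Sum>g\<in>rp_diag m n. y g * x f * rp_basis (g \<circ>\<^sub>m f) h)"

definition rp_star :: "nat \<Rightarrow> nat \<Rightarrow> rp_mor \<Rightarrow> rp_mor" where
  "rp_star m n x = (\<lambda>h. \<Sum>f\<in>rp_diag m n. cnj (x f) * rp_basis (dg_flip f) h)"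

definition rp_tensor :: "nat \<Rightarrow> nat \<Rightarrow> nat \<Rightarrow> nat \<Rightarrow> rp_mor \<Rightarrow> rp_mor \<Rightarrow> rp_mor" where
  "rp_tensor m n m' n' x y =
     (\<lambda>h. \<Sum>f\<in>rp_diag m n. \<Sum>g\<in>rp_diag m' n'. x f * y g * rp_basis (dg_tensor m n f g) h)"

section \<open>Hilbert RP-modules\<close>

record 'a hilb = "(complex, 'a) module" +
  hinner :: "'a \<Rightarrow> 'a \<Rightarrow> complex"

text \<open>
  The inner product is linear in the first argument.  Completeness is automatic
  in finite dimension.
\<close>

locale fd_hilbert_space = vectorspace "class_ring :: complex ring" H for H :: "'a hilb" (structure) +
  assumes finite_dimensional: "fin_dim"
    and hinner_add: "\<lbrakk>u \<in> carrier H; v \<in> carrier H; w \<in> carrier H\<rbrakk> \<Longrightarrow>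
          hinner H (u \<oplus> v) w = hinner H u w + hinner H v w"
    and hinner_smult: "\<lbrakk>v \<in> carrier H; w \<in> carrier H\<rbrakk> \<Longrightarrow>
          hinner H (c \<odot> v) w = c * hinner H v w"
    and hinner_cnj: "\<lbrakk>v \<in> carrier H; w \<in> carrier H\<rbrakk> \<Longrightarrow> hinner H w v = cnj (hinner H v w)"
    and hinner_pos: "\<lbrakk>v \<in> carrier H; v \<noteq> \<zero>\<rbrakk> \<Longrightarrow> 0 < Re (hinner H v v)"

text \<open>
  A functor: its spaces \<open>V\<^sub>n\<close> and the maps \<open>act V m n x\<close> from \<open>V\<^sub>m\<close> to \<open>V\<^sub>n\<close> for \<open>x\<close> in \<open>RP(m,n)\<close>.
  All the \<open>V\<^sub>n\<close> have their carriers in one type, but these are unrelated for different \<open>n\<close>.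
\<close>

record 'a rp_functor =
  obj :: "nat \<Rightarrow> 'a hilb"
  act :: "nat \<Rightarrow> nat \<Rightarrow> rp_mor \<Rightarrow> 'a \<Rightarrow> 'a"

locale hilbert_rp_module =
  fixes V :: "'a rp_functor"
  assumes hilbert: "fd_hilbert_space (obj V n)"
    and act_linear: "x \<in> carrier (RP m n) \<Longrightarrow>
          linear_map (class_ring :: complex ring) (obj V m) (obj V n) (act V m n x)"
    and act_id: "v \<in> carrier (obj V n) \<Longrightarrow> act V n n (rp_id n) v = v"
    and act_comp: "\<lbrakk>x \<in> carrier (RP l m); y \<in> carrier (RP m n); v \<in> carrier (obj V l)\<rbrakk> \<Longrightarrow>
          act V l n (rp_comp l m n y x) v = act V m n y (act V l m x v)"
    and act_add: "\<lbrakk>x \<in> carrier (RP m n); y \<in> carrier (RP m n); v \<in> carrier (obj V m)\<rbrakk> \<Longrightarrow>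
          act V m n (x \<oplus>\<^bsub>RP m n\<^esub> y) v = act V m n x v \<oplus>\<^bsub>obj V n\<^esub> act V m n y v"
    and act_smult: "\<lbrakk>x \<in> carrier (RP m n); v \<in> carrier (obj V m)\<rbrakk> \<Longrightarrow>
          act V m n (c \<odot>\<^bsub>RP m n\<^esub> x) v = c \<odot>\<^bsub>obj V n\<^esub> act V m n x v"
    and act_star: "\<lbrakk>x \<in> carrier (RP m n); v \<in> carrier (obj V m); w \<in> carrier (obj V n)\<rbrakk> \<Longrightarrow>
          hinner (obj V n) (act V m n x v) w = hinner (obj V m) v (act V n m (rp_star m n x) w)"

definition rp_submodule :: "'a rp_functor \<Rightarrow> (nat \<Rightarrow> 'a set) \<Rightarrow> bool" where
  "rp_submodule V W \<longleftrightarrow>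
     (\<forall>n. VectorSpace.subspace (class_ring :: complex ring) (W n) (obj V n)) \<and>
     (\<forall>m n. \<forall>x \<in> carrier (RP m n). \<forall>v \<in> W m. act V m n x v \<in> W n)"

definition rp_irreducible :: "'a rp_functor \<Rightarrow> bool" where
  "rp_irreducible V \<longleftrightarrow>
     (\<exists>n. carrier (obj V n) \<noteq> {\<zero>\<^bsub>obj V n\<^esub>}) \<and>
     (\<forall>W. rp_submodule V W \<longrightarrow>
        (\<forall>n. W n = {\<zero>\<^bsub>obj V n\<^esub>}) \<or> (\<forall>n. W n = carrier (obj V n)))"

definition rp_weight :: "'a rp_functor \<Rightarrow> nat" where
  "rp_weight V = (LEAST n. carrier (obj V n) \<noteq> {\<zero>\<^bsub>obj V n\<^esub>})"

text \<open>Isomorphism of Hilbert modules: a natural family of unitaries.\<close>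

definition rp_isomorphic :: "'a rp_functor \<Rightarrow> 'b rp_functor \<Rightarrow> bool" where
  "rp_isomorphic V W \<longleftrightarrow>
     (\<exists>U. (\<forall>n. linear_map (class_ring :: complex ring) (obj V n) (obj W n) (U n) \<and>
               bij_betw (U n) (carrier (obj V n)) (carrier (obj W n)) \<and>
               (\<forall>v \<in> carrier (obj V n). \<forall>w \<in> carrier (obj V n).
                  hinner (obj W n) (U n v) (U n w) = hinner (obj V n) v w)) \<and>
          (\<forall>m n. \<forall>x \<in> carrier (RP m n). \<forall>v \<in> carrier (obj V m).
                  U n (act V m n x v) = act W m n x (U m v)))"

section \<open>The modules \<open>V\<^sup>k\<close>\<close>

text \<open>The broken strand is the diagram without through strings, i.e. \<^term>\<open>Map.empty\<close>.\<close>

definition dotted_strand :: rp_mor where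
  "dotted_strand = (\<lambda>f. rp_id 1 f - rp_basis Map.empty f)"

primrec rp_proj :: "nat \<Rightarrow> rp_mor" where
  "rp_proj 0 = rp_id 0"
| "rp_proj (Suc k) = rp_tensor k k 1 1 (rp_proj k) dotted_strand"

definition RI :: "nat \<Rightarrow> rp_mor set" where
  "RI k = {x \<in> carrier (RP k k). \<forall>f. x f \<noteq> 0 \<longrightarrow> card (dom f) < k}"

text \<open>
  The functional \<open>tr\<close>.  It is determined on the carrier of \<open>RP k k\<close> only; \<^const>\<open>extensional\<close> fixes
  the irrelevant values elsewhere.
\<close>

definition rp_tr :: "nat \<Rightarrow> rp_mor \<Rightarrow> complex" where
  "rp_tr k = (THE t. t \<in> extensional (carrier (RP k k)) \<and>
     (\<forall>x \<in> carrier (RP k k). \<forall>y \<in> carrier (RP k k). t (x \<oplus>\<^bsub>RP k k\<^esub> y) = t x + t y) \<and>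
     (\<forall>c. \<forall>x \<in> carrier (RP k k). t (c \<odot>\<^bsub>RP k k\<^esub> x) = c * t x) \<and>
     t (rp_proj k) = 1 \<and> (\<forall>x \<in> RI k. t x = 0))"

definition rp_form :: "nat \<Rightarrow> nat \<Rightarrow> rp_mor \<Rightarrow> rp_mor \<Rightarrow> complex" where
  "rp_form k m a b = rp_tr k (rp_comp k m k (rp_star k m b) a)"

definition rp_radical :: "nat \<Rightarrow> nat \<Rightarrow> rp_mor set" where
  "rp_radical k m = {a \<in> carrier (RP k m). \<forall>b \<in> carrier (RP k m). rp_form k m a b = 0}"

text \<open>
  The quotient of \<open>RP(k,m)\<close> by the radical, with cosets as elements.  A set of representatives is
  turned into a coset by adding the radical; the inner product is the common value of
  the form on all pairs of representatives.
\<close>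

definition Vk_space :: "nat \<Rightarrow> nat \<Rightarrow> rp_mor set hilb" where
  "Vk_space k m =
     \<lparr> carrier = a_rcosets\<^bsub>RP k m\<^esub> (rp_radical k m),
       mult = undefined, one = undefined,
       zero = rp_radical k m,
       add = (\<lambda>X Y. X <+>\<^bsub>RP k m\<^esub> Y),
       smult = (\<lambda>c X. rp_radical k m <+>\<^bsub>RP k m\<^esub> ((\<lambda>a. c \<odot>\<^bsub>RP k m\<^esub> a) ` X)),
       hinner = (\<lambda>X Y. the_elem ((\<lambda>(a, b). rp_form k m a b) ` (X \<times> Y))) \<rparr>"

definition Vk :: "nat \<Rightarrow> rp_mor set rp_functor" where
  "Vk k = \<lparr> obj = Vk_space k,
            act = (\<lambda>m n x X. rp_radical k n <+>\<^bsub>RP k n\<^esub> (rp_comp k m n x ` X)) \<rparr>"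

end

theory Submission
  imports Defs
begin

text \<open>
  The functional \<open>tr\<close> reads off the coefficient of the identity diagram, so the form on \<open>RP(k,m)\<close> is
  the standard inner product of the coefficients at the diagrams with \<open>k\<close> through strings, and its
  radical consists of the morphisms whose coefficients at these diagrams all vanish.  If such a coefficient
  of \<open>a\<close> at \<open>f\<close> is nonzero, then \<open>f\<^sup>*a\<close> is a nonzero multiple of the identity modulo \<open>RI\<close>; hence every
  nonzero submodule of \<open>V\<^sup>k\<close> contains the class of the identity, which generates \<open>V\<^sup>k\<close>.

  Conversely, let \<open>W\<close> be irreducible of weight \<open>k\<close>.  A diagram in \<open>RP\<^sub>k\<close> with \<open>j < k\<close> through
  strings factors through \<open>[j]\<close> and so kills \<open>W\<^sub>k\<close>.  Therefore \<open>RP\<^sub>k\<close> acts on \<open>W\<^sub>k\<close> by the scalars \<open>tr\<close>.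
  For a unit vector \<open>v\<close> in \<open>W\<^sub>k\<close> this gives \<open>\<langle>av, bv\<rangle> = tr(b\<^sup>*a)\<close>, so \<open>a \<mapsto> av\<close> induces an isometry of \<open>V\<^sup>k\<close>
  into \<open>W\<close>, whose image is all of \<open>W\<close> by irreducibility.
\<close>

section \<open>Diagrams\<close>

text \<open>The one order equivalence carries both conditions. Strict growth keeps two strings from
  sharing a top point, and an injective monotone map is strictly increasing, hence reflects the
  order.\<close>

lemma rp_diag_iff:
  "f \<in> rp_diag m n \<longleftrightarrow>
     (\<forall>i j. f i = Some j \<longrightarrow> i \<in> {1..m} \<and> j \<in> {1..n}) \<and>
     (\<forall>i j i' j'. f i = Some j \<longrightarrow> f i' = Some j' \<longrightarrow> (i < i' \<longleftrightarrow> j < j'))"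
  (is "?L \<longleftrightarrow> ?R1 \<and> ?R2")
proof
  assume f: ?L
  then have dr: "dom f \<subseteq> {1..m}" "ran f \<subseteq> {1..n}" and inj: "inj_on f (dom f)"
    and mono: "mono_on (dom f) (\<lambda>i. the (f i))"
    by (auto simp: rp_diag_def)
  have lt: "j < j'" if "f i = Some j" "f i' = Some j'" "i < i'" for i j i' j'
  proof -
    have "j \<le> j'" using mono_onD[OF mono, of i i'] that by (auto simp: domI)
    moreover have "j \<noteq> j'" using inj_onD[OF inj, of i i'] that by (auto simp: domI)
    ultimately show ?thesis by simp
  qed
  have "i < i' \<longleftrightarrow> j < j'" if "f i = Some j" "f i' = Some j'" for i j i' j'
    using lt[of i j i' j'] lt[of i' j' i j] that
    by (metis less_asym nat_neq_iff option.inject)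
  moreover have ?R1 using dr by (auto simp: domI intro: ranI)
  ultimately show "?R1 \<and> ?R2" by blast
next
  assume R: "?R1 \<and> ?R2"
  have "inj_on f (dom f)"
  proof (rule inj_onI)
    fix i i' assume "i \<in> dom f" "i' \<in> dom f" "f i = f i'"
    with R show "i = i'" by (metis domD less_irrefl_nat linorder_neqE_nat)
  qed
  moreover have "mono_on (dom f) (\<lambda>i. the (f i))"
  proof (rule mono_onI)
    fix i i' assume "i \<in> dom f" "i' \<in> dom f" "i \<le> i'"
    with R show "the (f i) \<le> the (f i')"
      by (metis domD leD leI option.sel)
  qed
  ultimately show ?L using R by (auto simp: rp_diag_def ran_def)
qed

lemma rp_diag_range:
  assumes "f \<in> rp_diag m n" "f i = Some j"
  shows "i \<in> {1..m}" "j \<in> {1..n}"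
  using assms by (auto simp: rp_diag_iff)

lemma rp_diag_less_iff:
  "\<lbrakk>f \<in> rp_diag m n; f i = Some j; f i' = Some j'\<rbrakk> \<Longrightarrow> i < i' \<longleftrightarrow> j < j'"
  unfolding rp_diag_iff by blast

lemma rp_diag_inj: "\<lbrakk>f \<in> rp_diag m n; f i = Some j; f i' = Some j\<rbrakk> \<Longrightarrow> i = i'"
  using rp_diag_less_iff[of f m n i j i' j] rp_diag_less_iff[of f m n i' j i j]
  by (metis less_irrefl_nat linorder_neqE_nat)

lemma finite_rp_diag [simp, intro]: "finite (rp_diag m n)"
proof -
  have "rp_diag m n \<subseteq> {f. dom f \<subseteq> {1..m} \<and> ran f \<subseteq> {1..n}}"
    by (auto simp: rp_diag_def)
  also have "\<dots> = (\<Union>A\<in>Pow {1..m}. {f. dom f = A \<and> ran f \<subseteq> {1..n}})" by auto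
  finally show ?thesis
    by (rule finite_subset) (auto intro!: finite_set_of_finite_maps intro: finite_subset)
qed

lemma map_comp_rp_diag:
  assumes f: "f \<in> rp_diag l m" and g: "g \<in> rp_diag m n"
  shows "g \<circ>\<^sub>m f \<in> rp_diag l n"
  unfolding rp_diag_iff[of "g \<circ>\<^sub>m f"]
proof (intro conjI allI impI)
  fix i j assume "(g \<circ>\<^sub>m f) i = Some j"
  then obtain a where "f i = Some a" "g a = Some j" by (auto simp: map_comp_Some_iff)
  then show "i \<in> {1..l}" "j \<in> {1..n}" using rp_diag_range(1)[OF f] rp_diag_range(2)[OF g] by blast+
next
  fix i j i' j' assume "(g \<circ>\<^sub>m f) i = Some j" "(g \<circ>\<^sub>m f) i' = Some j'"
  then obtain a a' where "f i = Some a" "g a = Some j" "f i' = Some a'" "g a' = Some j'"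
    by (auto simp: map_comp_Some_iff)
  then show "i < i' \<longleftrightarrow> j < j'" using rp_diag_less_iff[OF f] rp_diag_less_iff[OF g] by blast
qed

lemma map_comp_assoc: "h \<circ>\<^sub>m (g \<circ>\<^sub>m f) = (h \<circ>\<^sub>m g) \<circ>\<^sub>m f"
  by (rule ext) (simp add: map_comp_def split: option.split)

lemma dg_id_rp_diag: "n \<le> n' \<Longrightarrow> dg_id n \<in> rp_diag n n'"
  by (auto simp: rp_diag_iff dg_id_def split: if_splits)

lemma dg_id_eq_Some: "dg_id n i = Some j \<longleftrightarrow> i \<in> {1..n} \<and> j = i"
  by (auto simp: dg_id_def)

lemma dom_dg_id [simp]: "dom (dg_id n) = {1..n}"
  by (auto simp: dg_id_def dom_def)

lemma map_eqI: "(\<And>i j. f i = Some j \<longleftrightarrow> g i = Some j) \<Longrightarrow> f = g"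
  by (rule ext) (metis not_Some_eq)

lemma dg_id_map_comp:
  assumes "f \<in> rp_diag m n" shows "dg_id n \<circ>\<^sub>m f = f"
  using rp_diag_range[OF assms]
  by (intro map_eqI) (auto simp: map_comp_Some_iff dg_id_eq_Some)

lemma map_comp_dg_id:
  assumes "f \<in> rp_diag m n" shows "f \<circ>\<^sub>m dg_id m = f"
  using rp_diag_range[OF assms]
  by (intro map_eqI) (auto simp: map_comp_Some_iff dg_id_eq_Some)

lemma dg_flip_eq_Some:
  assumes f: "f \<in> rp_diag m n"
  shows "dg_flip f j = Some i \<longleftrightarrow> f i = Some j"
proof -
  have "(THE i. f i = Some j) = i" if "f i = Some j" for i
    using that rp_diag_inj[OF f] by blast
  then show ?thesis by (auto simp: dg_flip_def ran_def)
qed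

lemma dg_flip_rp_diag: "f \<in> rp_diag m n \<Longrightarrow> dg_flip f \<in> rp_diag n m"
  unfolding rp_diag_iff[of "dg_flip f"]
  using rp_diag_range[of f m n] rp_diag_less_iff[of f m n] by (simp add: dg_flip_eq_Some)

lemma dg_flip_dg_flip: "f \<in> rp_diag m n \<Longrightarrow> dg_flip (dg_flip f) = f"
  by (rule map_eqI) (simp add: dg_flip_eq_Some[of _ n m] dg_flip_eq_Some dg_flip_rp_diag)

text \<open>These are the diagrams without caps. They index the coefficients on which the form on
  \<open>RP k m\<close> depends.\<close>

definition full_diag :: "nat \<Rightarrow> nat \<Rightarrow> diagram set" where
  "full_diag k m = {f \<in> rp_diag k m. dom f = {1..k}}"

lemma full_diagD: "f \<in> full_diag k m \<Longrightarrow> f \<in> rp_diag k m"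
  by (simp add: full_diag_def)

lemma finite_full_diag [simp, intro]: "finite (full_diag k m)"
  by (simp add: full_diag_def)

lemma dg_id_full_diag: "k \<le> m \<Longrightarrow> dg_id k \<in> full_diag k m"
  by (simp add: full_diag_def dg_id_rp_diag)

lemma card_dom_rp_diag:
  assumes f: "f \<in> rp_diag m n" shows "card (dom f) \<le> m" "card (dom f) \<le> n"
proof -
  have fin: "dom f \<subseteq> {1..m}" using f by (auto simp: rp_diag_def)
  then show "card (dom f) \<le> m" using card_mono[of "{1..m}" "dom f"] by simp
  have "inj_on (\<lambda>i. the (f i)) (dom f)"
    by (rule inj_onI) (auto dest: rp_diag_inj[OF f])
  moreover have "(\<lambda>i. the (f i)) ` dom f \<subseteq> {1..n}"
    using rp_diag_range[OF f] by auto
  ultimately have "card (dom f) \<le> card {1..n}" by (rule card_inj_on_le) simp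
  then show "card (dom f) \<le> n" by simp
qed

lemma full_diag_empty: "m < k \<Longrightarrow> full_diag k m = {}"
  using card_dom_rp_diag(2) by (force simp: full_diag_def)

text \<open>Links \<open>full_diag\<close> to the count of through strings in \<open>RI\<close>: a
  subset of \<open>{1..k}\<close> with \<open>k\<close> elements is all of it.\<close>

lemma full_diag_iff_card:
  assumes "f \<in> rp_diag k m" shows "f \<in> full_diag k m \<longleftrightarrow> card (dom f) = k"
  using assms card_subset_eq[of "{1..k}" "dom f"]
  by (auto simp: full_diag_def rp_diag_def)

text \<open>A strictly increasing self-map of \<open>{1..k}\<close> lies above the identity by
  upward induction and below it by downward induction.\<close>

lemma full_diag_self: "full_diag k k = {dg_id k}"
proof -
  have "f = dg_id k" if "f \<in> full_diag k k" for f
  proof -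
    let ?g = "\<lambda>i. the (f i)"
    have f: "f \<in> rp_diag k k" and dom: "dom f = {1..k}" using that by (auto simp: full_diag_def)
    have f_eq: "f i = Some (?g i)" if "i \<in> {1..k}" for i
      using that dom by (metis domIff option.collapse)
    have ge: "i \<in> {1..k} \<Longrightarrow> i \<le> ?g i" for i
    proof (induction i)
      case (Suc i)
      show ?case
      proof (cases "i = 0")
        case True
        then show ?thesis using rp_diag_range[OF f f_eq[OF Suc.prems]] by simp
      next
        case False
        then have i: "i \<in> {1..k}" using Suc.prems by simp
        then show ?thesis
          using Suc.IH rp_diag_less_iff[OF f f_eq[OF i] f_eq[OF Suc.prems]] by simp
      qed
    qed simp
    \<comment> \<open>Downward induction, with \<open>d\<close> the distance from the top point
      \<open>k\<close>; the bound \<open>d < k\<close> keeps \<open>k - d\<close> at least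
      1.\<close>
    have le: "d < k \<Longrightarrow> ?g (k - d) \<le> k - d" for d
    proof (induction d)
      case 0
      then show ?case using rp_diag_range[OF f f_eq[of k]] by simp
    next
      case (Suc d)
      then have "k - Suc d \<in> {1..k}" "k - d \<in> {1..k}" by auto
      from rp_diag_less_iff[OF f f_eq[OF this(1)] f_eq[OF this(2)]] Suc.IH Suc.prems
      show ?case by linarith
    qed
    show ?thesis
    proof
      fix i show "f i = dg_id k i"
      proof (cases "i \<in> {1..k}")
        case True
        then have "?g i = i" using ge[OF True] le[of "k - i"] by simp
        then show ?thesis using f_eq[OF True] True by (simp add: dg_id_def)
      next
        case False
        then show ?thesis using dom by (auto simp: dg_id_def domIff)
      qed
    qed
  qed
  then show ?thesis using dg_id_full_diag[of k k] by blast
qed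

text \<open>Stacking never creates through strings.\<close>

lemma map_comp_full_diagD:
  assumes "f \<in> rp_diag k m" "g \<circ>\<^sub>m f \<in> full_diag k n"
  shows "f \<in> full_diag k m"
proof -
  have "dom (g \<circ>\<^sub>m f) \<subseteq> dom f" by (auto simp: map_comp_Some_iff)
  moreover have "dom f \<subseteq> {1..k}" using assms by (auto simp: rp_diag_def)
  ultimately show ?thesis using assms by (auto simp: full_diag_def)
qed

text \<open>If no string of \<open>f\<close> is lost in \<open>g\<close>, every top end of a string
  of \<open>f\<close> lies in the domain of \<open>g\<close>, and there the flip undoes
  \<open>g\<close>.\<close>

lemma full_diag_flip:
  assumes f: "f \<in> full_diag k m" and g: "g \<in> rp_diag m n" and gf: "g \<circ>\<^sub>m f \<in> full_diag k n"
  shows "dg_flip g \<circ>\<^sub>m (g \<circ>\<^sub>m f) = f"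
proof (rule map_eqI)
  fix i j
  have "\<exists>l. g j = Some l" if "f i = Some j"
  proof -
    have "i \<in> dom (g \<circ>\<^sub>m f)" using f gf that by (auto simp: full_diag_def)
    then show ?thesis using that by (auto simp: map_comp_Some_iff)
  qed
  then show "(dg_flip g \<circ>\<^sub>m (g \<circ>\<^sub>m f)) i = Some j \<longleftrightarrow> f i = Some j"
    by (auto simp: map_comp_Some_iff dg_flip_eq_Some[OF g] dest: rp_diag_inj[OF g])
qed

text \<open>Both directions are instances of \<open>full_diag_flip\<close>, for \<open>g\<close> and
  for its flip. The equivalence trades stacking with the flip of \<open>g\<close> for stacking with
  \<open>g\<close>; it evaluates the form and makes it compatible with adjoints.\<close>

lemma full_diag_adjoint:
  assumes f: "f \<in> full_diag k m" and g: "g \<in> rp_diag m n" and h: "h \<in> rp_diag k n"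
  shows "dg_flip g \<circ>\<^sub>m h = f \<longleftrightarrow> h \<in> full_diag k n \<and> g \<circ>\<^sub>m f = h"
proof
  assume eq: "dg_flip g \<circ>\<^sub>m h = f"
  then have "h \<in> full_diag k n" using map_comp_full_diagD[OF h, of "dg_flip g" m] f by simp
  moreover have "g \<circ>\<^sub>m f = h"
    using full_diag_flip[OF \<open>h \<in> full_diag k n\<close> dg_flip_rp_diag[OF g]] eq f
    by (simp add: dg_flip_dg_flip[OF g])
  ultimately show "h \<in> full_diag k n \<and> g \<circ>\<^sub>m f = h" ..
next
  assume "h \<in> full_diag k n \<and> g \<circ>\<^sub>m f = h"
  then show "dg_flip g \<circ>\<^sub>m h = f" using full_diag_flip[OF f g] by auto
qed

text \<open>The middle object has as many points as \<open>f\<close> has through strings; \<open>h\<close> numbers these strings.\<close>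

lemma rp_diag_factor:
  assumes f: "f \<in> rp_diag m n"
  obtains g h where "h \<in> rp_diag m (card (dom f))" "g \<in> rp_diag (card (dom f)) n" "f = g \<circ>\<^sub>m h"
proof -
  define h where "h = (\<lambda>i. if i \<in> dom f then Some (card (dom f \<inter> {..i})) else None)"
  have fin: "finite (dom f)" using f by (auto simp: rp_diag_def intro: finite_subset)
  have less: "card (dom f \<inter> {..i}) < card (dom f \<inter> {..i'})" if "i < i'" "i' \<in> dom f" for i i'
  proof (rule psubset_card_mono)
    have "i' \<in> dom f \<inter> {..i'}" "i' \<notin> dom f \<inter> {..i}" using that by auto
    then show "dom f \<inter> {..i} \<subset> dom f \<inter> {..i'}" using that(1) by fastforce
  qed (simp add: fin)
  have iff: "i < i' \<longleftrightarrow> card (dom f \<inter> {..i}) < card (dom f \<inter> {..i'})"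
    if "i \<in> dom f" "i' \<in> dom f" for i i'
    using less[of i i'] less[of i' i] that by (metis less_asym linorder_neqE_nat)
  have "card (dom f \<inter> {..i}) \<in> {1..card (dom f)}" if "i \<in> dom f" for i
  proof -
    have "card (dom f \<inter> {..i}) > 0" using that fin by (auto simp: card_gt_0_iff)
    moreover have "card (dom f \<inter> {..i}) \<le> card (dom f)" by (rule card_mono) (auto simp: fin)
    ultimately show ?thesis by simp
  qed
  then have h: "h \<in> rp_diag m (card (dom f))"
    using f iff unfolding rp_diag_iff[of h]
    by (auto simp: h_def rp_diag_def split: if_splits)
  \<comment> \<open>The second factor goes back from the number of a string to its bottom point and
    then follows \<open>f\<close>.\<close>
  have "f = (f \<circ>\<^sub>m dg_flip h) \<circ>\<^sub>m h"
  proof (rule map_eqI)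
    fix i j
    have "(\<exists>a b. h i = Some a \<and> h b = Some a \<and> f b = Some j) \<longleftrightarrow> f i = Some j"
    proof
      assume "f i = Some j"
      then have "h i = Some (card (dom f \<inter> {..i}))" by (auto simp: h_def)
      with \<open>f i = Some j\<close> show "\<exists>a b. h i = Some a \<and> h b = Some a \<and> f b = Some j" by blast
    qed (use rp_diag_inj[OF h] in blast)
    then show "f i = Some j \<longleftrightarrow> ((f \<circ>\<^sub>m dg_flip h) \<circ>\<^sub>m h) i = Some j"
      by (simp add: map_comp_Some_iff dg_flip_eq_Some[OF h])
  qed
  then show ?thesis
    using that[OF h map_comp_rp_diag[OF dg_flip_rp_diag[OF h] f]] by blast
qed

section \<open>Morphisms\<close>

lemma RP_carrier_iff: "x \<in> carrier (RP m n) \<longleftrightarrow> (\<forall>f. f \<notin> rp_diag m n \<longrightarrow> x f = 0)"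
  by (auto simp: RP_def)

lemma RP_carrierD: "\<lbrakk>x \<in> carrier (RP m n); f \<notin> rp_diag m n\<rbrakk> \<Longrightarrow> x f = 0"
  by (simp add: RP_carrier_iff)

lemma RP_simps [simp]:
  "zero (RP m n) = (\<lambda>f. 0)"
  "add (RP m n) = (\<lambda>x y f. x f + y f)"
  "smult (RP m n) = (\<lambda>c x f. c * x f)"
  by (simp_all add: RP_def)

lemma RP_closed [simp, intro]:
  "(\<lambda>f. 0) \<in> carrier (RP m n)"
  "\<lbrakk>x \<in> carrier (RP m n); y \<in> carrier (RP m n)\<rbrakk> \<Longrightarrow> (\<lambda>f. x f + y f) \<in> carrier (RP m n)"
  "\<lbrakk>x \<in> carrier (RP m n); y \<in> carrier (RP m n)\<rbrakk> \<Longrightarrow> (\<lambda>f. x f - y f) \<in> carrier (RP m n)"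
  "x \<in> carrier (RP m n) \<Longrightarrow> (\<lambda>f. c * x f) \<in> carrier (RP m n)"
  "x \<in> carrier (RP m n) \<Longrightarrow> (\<lambda>f. - x f) \<in> carrier (RP m n)"
  by (simp_all add: RP_carrier_iff)

lemma rp_basis_closed: "f \<in> rp_diag m n \<Longrightarrow> rp_basis f \<in> carrier (RP m n)"
  by (auto simp: RP_carrier_iff rp_basis_def)

lemma rp_id_closed [simp, intro]: "rp_id n \<in> carrier (RP n n)"
  by (simp add: rp_id_def dg_id_rp_diag rp_basis_closed)

text \<open>Finite support reduces linear statements to diagrams. The case \<open>basis\<close>
  remembers that \<open>f\<close> occurs in \<open>x\<close>, so for \<open>x\<close> in
  \<open>RI k\<close> only diagrams with fewer than \<open>k\<close> through strings arise.\<close>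

lemma RP_induct [consumes 1, case_names zero basis add smult]:
  assumes x: "x \<in> carrier (RP m n)"
    and zero: "P (\<lambda>f. 0)"
    and basis: "\<And>f. \<lbrakk>f \<in> rp_diag m n; x f \<noteq> 0\<rbrakk> \<Longrightarrow> P (rp_basis f)"
    and add: "\<And>y z. \<lbrakk>y \<in> carrier (RP m n); z \<in> carrier (RP m n); P y; P z\<rbrakk> \<Longrightarrow> P (\<lambda>f. y f + z f)"
    and smult: "\<And>c y. \<lbrakk>y \<in> carrier (RP m n); P y\<rbrakk> \<Longrightarrow> P (\<lambda>f. c * y f)"
  shows "P x"
proof -
  \<comment> \<open>The morphism is built up from its truncations to finite subsets \<open>S\<close>
    of its support.\<close>
  have "(\<lambda>f. if f \<in> S then x f else 0) \<in> carrier (RP m n) \<and> P (\<lambda>f. if f \<in> S then x f else 0)"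
    if "finite S" "S \<subseteq> {f. x f \<noteq> 0}" for S
    using that
  proof (induction S rule: finite_induct)
    case empty
    then show ?case using zero by simp
  next
    case (insert g S)
    then have g: "x g \<noteq> 0" "g \<in> rp_diag m n" using RP_carrierD[OF x] by auto
    let ?y = "\<lambda>f. x g * rp_basis g f" and ?z = "\<lambda>f. if f \<in> S then x f else 0"
    have "?y \<in> carrier (RP m n)" "P ?y"
      using smult[OF _ basis[of g]] g by (auto intro: rp_basis_closed)
    moreover have "?z \<in> carrier (RP m n)" "P ?z" using insert by auto
    moreover have "(\<lambda>f. if f \<in> insert g S then x f else 0) = (\<lambda>f. ?y f + ?z f)"
      using insert.hyps by (auto simp: rp_basis_def)
    ultimately show ?case using add by auto
  qed
  moreover have "finite {f. x f \<noteq> 0}"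
    by (rule finite_subset[OF _ finite_rp_diag[of m n]]) (use RP_carrierD[OF x] in auto)
  ultimately have "P (\<lambda>f. if f \<in> {f. x f \<noteq> 0} then x f else 0)" by blast
  moreover have "(\<lambda>f. if f \<in> {f. x f \<noteq> 0} then x f else 0) = x" by auto
  ultimately show ?thesis by metis
qed

section \<open>Composition and adjoints of morphisms\<close>

lemma rp_comp_eq:
  "rp_comp l m n y x h =
     (\<Sum>f\<in>rp_diag l m. \<Sum>g\<in>rp_diag m n. y g * x f * (if h = g \<circ>\<^sub>m f then 1 else 0))"
  by (simp add: rp_comp_def rp_basis_def)

lemma rp_comp_closed [simp, intro]: "rp_comp l m n y x \<in> carrier (RP l n)"
  by (auto simp: RP_carrier_iff rp_comp_eq map_comp_rp_diag intro!: sum.neutral)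

text \<open>Each pair \<open>f\<close>, \<open>g\<close> contributes to a single \<open>h\<close>,
  so the sum over \<open>h\<close> collapses. The free weight \<open>F\<close> allows indicator sums
  (associativity) and conjugated coefficients (the form).\<close>

lemma sum_rp_comp:
  "(\<Sum>h\<in>rp_diag l n. rp_comp l m n y x h * F h) =
     (\<Sum>f\<in>rp_diag l m. \<Sum>g\<in>rp_diag m n. y g * x f * F (g \<circ>\<^sub>m f))"
proof -
  have "(\<Sum>h\<in>rp_diag l n. rp_comp l m n y x h * F h) =
      (\<Sum>h\<in>rp_diag l n. \<Sum>f\<in>rp_diag l m. \<Sum>g\<in>rp_diag m n.
        y g * x f * (if h = g \<circ>\<^sub>m f then F h else 0))"
    by (simp add: rp_comp_eq sum_distrib_right if_distrib if_distribR mult.assoc cong: if_cong)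
  also have "\<dots> = (\<Sum>f\<in>rp_diag l m. \<Sum>g\<in>rp_diag m n. \<Sum>h\<in>rp_diag l n.
        y g * x f * (if h = g \<circ>\<^sub>m f then F h else 0))"
    by (subst sum.swap, rule sum.cong[OF refl], rule sum.swap)
  also have "\<dots> = (\<Sum>f\<in>rp_diag l m. \<Sum>g\<in>rp_diag m n. y g * x f * F (g \<circ>\<^sub>m f))"
    by (intro sum.cong refl) (simp add: map_comp_rp_diag flip: sum_distrib_left)
  finally show ?thesis .
qed

text \<open>By \<open>sum_rp_comp\<close>, both sides expand into the same triple sum over diagrams,
  where associativity of partial maps applies.\<close>

lemma rp_comp_assoc:
  "rp_comp k m n y (rp_comp k l m x a) = rp_comp k l n (rp_comp l m n y x) a"
proof
  fix h :: diagram
  let ?d = "\<lambda>f. if h = f then 1 else 0 :: complex"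
  have "rp_comp k m n y (rp_comp k l m x a) h =
      (\<Sum>f\<in>rp_diag k m. rp_comp k l m x a f * (\<Sum>g\<in>rp_diag m n. y g * ?d (g \<circ>\<^sub>m f)))"
    unfolding rp_comp_eq[of k m n] sum_distrib_left by (intro sum.cong refl) simp
  also have "\<dots> = (\<Sum>f\<in>rp_diag k l. \<Sum>g\<in>rp_diag l m. x g * a f *
      (\<Sum>g'\<in>rp_diag m n. y g' * ?d (g' \<circ>\<^sub>m (g \<circ>\<^sub>m f))))"
    by (rule sum_rp_comp)
  also have "\<dots> = (\<Sum>f\<in>rp_diag k l. a f * (\<Sum>g\<in>rp_diag l m. \<Sum>g'\<in>rp_diag m n. y g' * x g *
      ?d ((g' \<circ>\<^sub>m g) \<circ>\<^sub>m f)))"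
    unfolding sum_distrib_left by (intro sum.cong refl) (simp add: map_comp_assoc)
  also have "\<dots> = (\<Sum>f\<in>rp_diag k l. a f * (\<Sum>g\<in>rp_diag l n. rp_comp l m n y x g * ?d (g \<circ>\<^sub>m f)))"
    by (simp only: sum_rp_comp)
  also have "\<dots> = rp_comp k l n (rp_comp l m n y x) a h"
    unfolding rp_comp_eq[of k l n] sum_distrib_left by (intro sum.cong refl) simp
  finally show "rp_comp k m n y (rp_comp k l m x a) h = rp_comp k l n (rp_comp l m n y x) a h" .
qed

lemma rp_comp_linear:
  "rp_comp l m n (\<lambda>f. y f + y' f) x = (\<lambda>f. rp_comp l m n y x f + rp_comp l m n y' x f)"
  "rp_comp l m n y (\<lambda>f. x f + x' f) = (\<lambda>f. rp_comp l m n y x f + rp_comp l m n y x' f)"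
  "rp_comp l m n (\<lambda>f. c * y f) x = (\<lambda>f. c * rp_comp l m n y x f)"
  "rp_comp l m n y (\<lambda>f. c * x f) = (\<lambda>f. c * rp_comp l m n y x f)"
  by (simp_all only: fun_eq_iff rp_comp_eq distrib_left distrib_right sum.distrib
      sum_distrib_left mult.assoc mult.left_commute[of _ c] simp_thms)

lemma rp_comp_basis:
  assumes "f \<in> rp_diag l m" "g \<in> rp_diag m n"
  shows "rp_comp l m n (rp_basis g) (rp_basis f) = rp_basis (g \<circ>\<^sub>m f)"
proof
  fix h
  have "rp_comp l m n (rp_basis g) (rp_basis f) h =
      (\<Sum>f'\<in>rp_diag l m. \<Sum>g'\<in>rp_diag m n.
         if g' = g then if f' = f then rp_basis (g \<circ>\<^sub>m f) h else 0 else 0)"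
    unfolding rp_comp_eq by (intro sum.cong refl) (simp add: rp_basis_def)
  then show "rp_comp l m n (rp_basis g) (rp_basis f) h = rp_basis (g \<circ>\<^sub>m f) h"
    using assms by simp
qed

lemma rp_comp_zero:
  "rp_comp l m n (\<lambda>f. 0) x = (\<lambda>f. 0)" "rp_comp l m n y (\<lambda>f. 0) = (\<lambda>f. 0)"
  by (simp_all add: rp_comp_eq fun_eq_iff)

lemma rp_id_comp:
  assumes "x \<in> carrier (RP m n)" shows "rp_comp m n n (rp_id n) x = x"
  using assms by (induction rule: RP_induct)
    (simp_all add: rp_comp_zero rp_id_def rp_comp_basis dg_id_rp_diag dg_id_map_comp rp_comp_linear)

lemma rp_comp_id:
  assumes "x \<in> carrier (RP m n)" shows "rp_comp m m n x (rp_id m) = x"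
  using assms by (induction rule: RP_induct)
    (simp_all add: rp_comp_zero rp_id_def rp_comp_basis dg_id_rp_diag map_comp_dg_id rp_comp_linear)

lemma sum_rp_diag_flip: "(\<Sum>g\<in>rp_diag n m. F g) = (\<Sum>g\<in>rp_diag m n. F (dg_flip g))"
  by (rule sum.reindex_bij_witness[of _ dg_flip dg_flip])
    (auto simp: dg_flip_rp_diag dg_flip_dg_flip)

lemma rp_star_eq: "rp_star m n x h = (if h \<in> rp_diag n m then cnj (x (dg_flip h)) else 0)"
proof -
  have "rp_star m n x h = (\<Sum>g\<in>rp_diag n m. cnj (x (dg_flip g)) * rp_basis g h)"
    unfolding rp_star_def sum_rp_diag_flip[of _ m n]
    by (intro sum.cong refl) (simp add: dg_flip_dg_flip)
  also have "\<dots> = (\<Sum>g\<in>rp_diag n m. if h = g then cnj (x (dg_flip g)) else 0)"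
    by (intro sum.cong refl) (simp add: rp_basis_def)
  finally show ?thesis by simp
qed

lemma rp_star_closed [simp, intro]: "rp_star m n x \<in> carrier (RP n m)"
  by (simp add: RP_carrier_iff rp_star_eq)

lemma rp_star_flip: "g \<in> rp_diag m n \<Longrightarrow> rp_star m n x (dg_flip g) = cnj (x g)"
  by (simp add: rp_star_eq dg_flip_rp_diag dg_flip_dg_flip)

section \<open>The trace and the form\<close>

text \<open>\<open>rp_tensor\<close> is supported on juxtapositions of diagrams, so a case split on
  \<open>k\<close> suffices: juxtaposing with a diagram in \<open>rp_diag 1 1\<close> adds at most
  the string from \<open>Suc j\<close> to \<open>Suc j\<close>.\<close>

lemma rp_proj_closed [simp, intro]: "rp_proj k \<in> carrier (RP k k)"
proof (cases k)
  case (Suc j)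
  have "dg_tensor j j f g \<in> rp_diag (Suc j) (Suc j)" if "f \<in> rp_diag j j" "g \<in> rp_diag 1 1" for f g
  proof -
    have iff: "dg_tensor j j f g i = Some a \<longleftrightarrow> f i = Some a \<or> i = Suc j \<and> a = Suc j \<and> g 1 = Some 1" for i a
    proof (cases "i \<le> j")
      case False
      then have "dg_tensor j j f g i = Some a \<longleftrightarrow> (\<exists>c. g (i - j) = Some c \<and> a = j + c)"
        by (auto simp: dg_tensor_def)
      also have "\<dots> \<longleftrightarrow> i = Suc j \<and> a = Suc j \<and> g 1 = Some 1"
      proof
        assume "\<exists>c. g (i - j) = Some c \<and> a = j + c"
        then obtain c where c: "g (i - j) = Some c" "a = j + c" by blast
        with rp_diag_range[OF that(2) c(1)] have "i - j = 1" "c = 1" by auto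
        with c False show "i = Suc j \<and> a = Suc j \<and> g 1 = Some 1" by simp
      qed simp
      finally show ?thesis using rp_diag_range(1)[OF that(1), of i a] False by auto
    qed (auto simp: dg_tensor_def)
    show ?thesis
      unfolding rp_diag_iff[of "dg_tensor j j f g"] iff
    proof (intro conjI allI impI; elim disjE)
      fix i a i' a' assume "f i = Some a" "f i' = Some a'"
      then show "i < i' \<longleftrightarrow> a < a'" by (rule rp_diag_less_iff[OF that(1)])
    qed (use rp_diag_range[OF that(1)] in \<open>force simp: less_Suc_eq_le\<close>)+
  qed
  then show ?thesis
    by (auto simp: Suc RP_carrier_iff rp_tensor_def rp_basis_def intro!: sum.neutral)
qed simp

text \<open>When the product of dotted strands is expanded, only the choice of the unbroken strand
  in every factor gives the identity diagram.\<close>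

lemma rp_proj_dg_id: "rp_proj k (dg_id k) = 1"
proof (induction k)
  case 0
  then show ?case by (simp add: rp_id_def rp_basis_def)
next
  case (Suc k)
  have iff: "dg_tensor k k f g = dg_id (Suc k) \<longleftrightarrow> f = dg_id k \<and> g = dg_id 1"
    if f: "f \<in> rp_diag k k" and g: "g \<in> rp_diag 1 1" for f g
  proof
    assume eq: "dg_tensor k k f g = dg_id (Suc k)"
    have "f i = dg_id k i" for i
    proof (cases "i \<le> k")
      case True
      then show ?thesis using fun_cong[OF eq, of i] by (simp add: dg_tensor_def dg_id_def)
    next
      case False
      then have "f i = None" using rp_diag_range(1)[OF f, of i] by (cases "f i") auto
      with False show ?thesis by (simp add: dg_id_def)
    qed
    moreover have "g i = dg_id 1 i" for i
    proof (cases "i = 1")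
      case True
      then show ?thesis using fun_cong[OF eq, of "Suc k"]
        by (simp add: dg_tensor_def dg_id_def)
    next
      case False
      then have "g i = None" using rp_diag_range(1)[OF g, of i] by (cases "g i") auto
      with False show ?thesis by (simp add: dg_id_def)
    qed
    ultimately show "f = dg_id k \<and> g = dg_id 1" by blast
  next
    assume fg: "f = dg_id k \<and> g = dg_id 1"
    have "dg_tensor k k (dg_id k) (dg_id 1) = dg_id (Suc k)"
    proof
      fix i show "dg_tensor k k (dg_id k) (dg_id 1) i = dg_id (Suc k) i"
        by (cases "i \<le> k"; cases "i = Suc k") (auto simp: dg_tensor_def dg_id_def)
    qed
    with fg show "dg_tensor k k f g = dg_id (Suc k)" by simp
  qed
  have "rp_proj (Suc k) (dg_id (Suc k)) = (\<Sum>f\<in>rp_diag k k. \<Sum>g\<in>rp_diag 1 1.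
      if f = dg_id k then if g = dg_id 1 then rp_proj k f * dotted_strand g else 0 else 0)"
    unfolding rp_proj.simps rp_tensor_def
    by (intro sum.cong refl) (simp add: rp_basis_def iff eq_commute[of "dg_id (Suc k)"])
  also have "\<dots> = (\<Sum>f\<in>rp_diag k k. if f = dg_id k then \<Sum>g\<in>rp_diag 1 1.
      if g = dg_id 1 then rp_proj k f * dotted_strand g else 0 else 0)"
    by (intro sum.cong refl) simp
  also have "\<dots> = dotted_strand (dg_id 1)"
    using Suc.IH by (simp add: dg_id_rp_diag)
  also have "\<dots> = 1"
    by (auto simp: dotted_strand_def rp_id_def rp_basis_def dg_id_def fun_eq_iff)
  finally show ?case .
qed

text \<open>By \<open>full_diag_self\<close>, the identity is the only diagram in
  \<open>rp_diag k k\<close> with \<open>k\<close> through strings, so the ideal is the kernel of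
  one coordinate functional.\<close>

lemma RI_eq: "RI k = {x \<in> carrier (RP k k). x (dg_id k) = 0}"
proof -
  have *: "card (dom f) < k \<longleftrightarrow> f \<noteq> dg_id k" if "f \<in> rp_diag k k" for f
    using full_diag_iff_card[OF that] card_dom_rp_diag(1)[OF that] full_diag_self[of k]
    by (auto simp: le_less)
  show ?thesis
    unfolding RI_def using * dg_id_rp_diag[of k k] by (blast dest: RP_carrierD)
qed

text \<open>The coordinate at the identity satisfies the defining conditions. They determine the
  functional because \<open>rp_proj k\<close> and \<open>RI k\<close> together span
  \<open>RP k k\<close>.\<close>

lemma rp_tr_eq:
  assumes "x \<in> carrier (RP k k)" shows "rp_tr k x = x (dg_id k)"
proof -
  let ?C = "carrier (RP k k)"
  let ?P = "\<lambda>t. t \<in> extensional ?C \<and>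
     (\<forall>x \<in> ?C. \<forall>y \<in> ?C. t (x \<oplus>\<^bsub>RP k k\<^esub> y) = t x + t y) \<and>
     (\<forall>c. \<forall>x \<in> ?C. t (c \<odot>\<^bsub>RP k k\<^esub> x) = c * t x) \<and>
     t (rp_proj k) = 1 \<and> (\<forall>x \<in> RI k. t x = 0)"
  have "rp_tr k = restrict (\<lambda>x. x (dg_id k)) ?C"
    unfolding rp_tr_def
  proof (rule the_equality)
    show "?P (restrict (\<lambda>x. x (dg_id k)) ?C)"
      by (auto simp: rp_proj_dg_id RI_eq)
  next
    fix t assume t: "?P t"
    then have add: "t (\<lambda>f. y f + z f) = t y + t z" if "y \<in> ?C" "z \<in> ?C" for y z
      using that by simp
    have "t x = x (dg_id k)" if x: "x \<in> ?C" for x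
    proof -
      \<comment> \<open>Splits \<open>x\<close> into a multiple of \<open>rp_proj k\<close> and a
        remainder in \<open>RI k\<close>.\<close>
      let ?p = "\<lambda>f. x (dg_id k) * rp_proj k f" and ?r = "\<lambda>f. x f - x (dg_id k) * rp_proj k f"
      have "?r \<in> RI k" using x by (simp add: RI_eq rp_proj_dg_id)
      then have "t ?r = 0" using t by blast
      moreover have "t ?p = x (dg_id k)" using t by simp
      moreover have "t (\<lambda>f. ?p f + ?r f) = t ?p + t ?r"
        by (intro add RP_closed rp_proj_closed x)
      ultimately show ?thesis by simp
    qed
    then show "t = restrict (\<lambda>x. x (dg_id k)) ?C"
      using t by (auto simp: extensional_def restrict_def)
  qed
  then show ?thesis using assms by simp
qed

text \<open>The flip of \<open>g\<close> stacked on \<open>f\<close> is the identity only if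
  \<open>f = g\<close> has no caps. So the diagrams without caps are orthonormal and all others lie
  in the radical.\<close>

lemma rp_form_eq:
  assumes "a \<in> carrier (RP k m)" "b \<in> carrier (RP k m)"
  shows "rp_form k m a b = (\<Sum>f\<in>full_diag k m. a f * cnj (b f))"
proof -
  have "rp_form k m a b = rp_comp k m k (rp_star k m b) a (dg_id k)"
    by (simp add: rp_form_def rp_tr_eq)
  also have "\<dots> = (\<Sum>f\<in>rp_diag k m. \<Sum>g\<in>rp_diag k m.
      cnj (b g) * a f * (if dg_flip g \<circ>\<^sub>m f = dg_id k then 1 else 0))"
    unfolding rp_comp_eq sum_rp_diag_flip[of _ m k]
    by (intro sum.cong refl) (simp add: rp_star_flip eq_commute[of "dg_id k"])
  also have "\<dots> = (\<Sum>f\<in>rp_diag k m. \<Sum>g\<in>rp_diag k m.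
      if f = g then if f \<in> full_diag k m then a f * cnj (b f) else 0 else 0)"
    by (intro sum.cong refl)
      (auto simp: full_diag_adjoint[OF dg_id_full_diag[OF order_refl]] map_comp_dg_id)
  also have "\<dots> = (\<Sum>f\<in>rp_diag k m. if f \<in> full_diag k m then a f * cnj (b f) else 0)"
    by simp
  also have "\<dots> = (\<Sum>f\<in>full_diag k m. a f * cnj (b f))"
    by (rule sum.mono_neutral_cong_right) (auto dest: full_diagD)
  finally show ?thesis .
qed

text \<open>Both sides become sums over pairs \<open>f\<close>, \<open>g\<close> for which
  \<open>f\<close> and the composite of \<open>f\<close> followed by \<open>g\<close> have no caps,
  with equal terms.\<close>

lemma rp_form_adjoint:
  assumes x: "x \<in> carrier (RP m n)" and a: "a \<in> carrier (RP k m)" and b: "b \<in> carrier (RP k n)"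
  shows "rp_form k n (rp_comp k m n x a) b = rp_form k m a (rp_comp k n m (rp_star m n x) b)"
proof -
  \<comment> \<open>By \<open>full_diag_adjoint\<close>, each \<open>g\<close> leaves a single
    \<open>h\<close>, namely \<open>f\<close> followed by \<open>g\<close>.\<close>
  have comp_star: "rp_comp k n m (rp_star m n x) b f =
      (\<Sum>g\<in>rp_diag m n. if g \<circ>\<^sub>m f \<in> full_diag k n then cnj (x g) * b (g \<circ>\<^sub>m f) else 0)"
    if f: "f \<in> full_diag k m" for f
  proof -
    have "rp_comp k n m (rp_star m n x) b f = (\<Sum>h\<in>rp_diag k n. \<Sum>g\<in>rp_diag m n.
        cnj (x g) * b h * (if dg_flip g \<circ>\<^sub>m h = f then 1 else 0))"
      unfolding rp_comp_eq sum_rp_diag_flip[of _ n m]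
      by (intro sum.cong refl) (simp add: rp_star_flip eq_commute[of f])
    also have "\<dots> = (\<Sum>g\<in>rp_diag m n. \<Sum>h\<in>rp_diag k n.
        if g \<circ>\<^sub>m f = h then if h \<in> full_diag k n then cnj (x g) * b h else 0 else 0)"
      by (subst sum.swap, intro sum.cong refl) (simp add: full_diag_adjoint[OF f])
    also have "\<dots> = (\<Sum>g\<in>rp_diag m n.
        if g \<circ>\<^sub>m f \<in> full_diag k n then cnj (x g) * b (g \<circ>\<^sub>m f) else 0)"
      by (intro sum.cong refl) (simp add: map_comp_rp_diag[OF full_diagD[OF f]])
    finally show ?thesis .
  qed
  have "rp_form k n (rp_comp k m n x a) b =
      (\<Sum>h\<in>rp_diag k n. rp_comp k m n x a h * (if h \<in> full_diag k n then cnj (b h) else 0))"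
    unfolding rp_form_eq[OF rp_comp_closed b]
    by (rule sum.mono_neutral_cong_left) (auto dest: full_diagD)
  also have "\<dots> = (\<Sum>f\<in>rp_diag k m. \<Sum>g\<in>rp_diag m n.
      x g * a f * (if g \<circ>\<^sub>m f \<in> full_diag k n then cnj (b (g \<circ>\<^sub>m f)) else 0))"
    by (rule sum_rp_comp)
  \<comment> \<open>A composite without caps forces \<open>f\<close> to have none, so the other
    terms vanish.\<close>
  also have "\<dots> = (\<Sum>f\<in>full_diag k m. \<Sum>g\<in>rp_diag m n.
      x g * a f * (if g \<circ>\<^sub>m f \<in> full_diag k n then cnj (b (g \<circ>\<^sub>m f)) else 0))"
    by (rule sum.mono_neutral_right)
      (auto dest: full_diagD map_comp_full_diagD intro!: sum.neutral)
  also have "\<dots> = (\<Sum>f\<in>full_diag k m. a f * cnj (rp_comp k n m (rp_star m n x) b f))"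
    by (intro sum.cong refl) (auto simp: comp_star sum_distrib_left intro!: sum.cong)
  also have "\<dots> = rp_form k m a (rp_comp k n m (rp_star m n x) b)"
    using a by (simp add: rp_form_eq)
  finally show ?thesis .
qed

section \<open>The modules \<open>V\<^sup>k\<close>\<close>

text \<open>This is the coset of \<open>a\<close> modulo the radical, described by coordinates;
  \<open>rp_radical_eq\<close> and \<open>Vk_carrier\<close> justify the description.\<close>

definition rp_class :: "nat \<Rightarrow> nat \<Rightarrow> rp_mor \<Rightarrow> rp_mor set" where
  "rp_class k m a = {b \<in> carrier (RP k m). \<forall>f\<in>full_diag k m. b f = a f}"

lemma rp_class_self: "a \<in> carrier (RP k m) \<Longrightarrow> a \<in> rp_class k m a"
  by (simp add: rp_class_def)

lemma rp_class_eq_iff: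
  assumes "a \<in> carrier (RP k m)"
  shows "rp_class k m a = rp_class k m b \<longleftrightarrow> (\<forall>f\<in>full_diag k m. a f = b f)"
  using assms by (auto simp: rp_class_def)

lemma rp_form_basis:
  assumes a: "a \<in> carrier (RP k m)" and f: "f \<in> full_diag k m"
  shows "rp_form k m a (rp_basis f) = a f"
proof -
  have "rp_form k m a (rp_basis f) = (\<Sum>g\<in>full_diag k m. if g = f then a g else 0)"
    unfolding rp_form_eq[OF a rp_basis_closed[OF full_diagD[OF f]]]
    by (intro sum.cong refl) (simp add: rp_basis_def)
  then show ?thesis using f by simp
qed

text \<open>Pairing with the diagram \<open>f\<close> extracts the coefficient at \<open>f\<close>,
  so radical elements vanish on \<open>full_diag k m\<close>.\<close>

lemma rp_radical_eq: "rp_radical k m = rp_class k m (\<lambda>f. 0)"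
proof -
  have "a f = 0" if "a \<in> rp_radical k m" "f \<in> full_diag k m" for a f
    using that rp_form_basis[of a k m f] rp_basis_closed[OF full_diagD[OF that(2)]]
    by (auto simp: rp_radical_def)
  then show ?thesis
    by (auto simp: rp_class_def rp_form_eq rp_radical_def)
qed

lemma rp_set_add: "X <+>\<^bsub>RP k m\<^esub> Y = (\<Union>x\<in>X. \<Union>y\<in>Y. {\<lambda>f. x f + y f})"
  by (simp add: set_add_def set_mult_def)

text \<open>Allowing any nonempty part \<open>S\<close> of a class covers single representatives,
  whole cosets, and the images of cosets under scalars and morphisms, which need not be whole
  cosets.\<close>

lemma rp_class_add:
  assumes S: "S \<subseteq> rp_class k m b" "S \<noteq> {}" and a: "a \<in> carrier (RP k m)"
  shows "rp_class k m a <+>\<^bsub>RP k m\<^esub> S = rp_class k m (\<lambda>f. a f + b f)"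
proof
  show "rp_class k m a <+>\<^bsub>RP k m\<^esub> S \<subseteq> rp_class k m (\<lambda>f. a f + b f)"
    using S(1) by (fastforce simp: rp_set_add rp_class_def)
  show "rp_class k m (\<lambda>f. a f + b f) \<subseteq> rp_class k m a <+>\<^bsub>RP k m\<^esub> S"
  proof
    fix c assume c: "c \<in> rp_class k m (\<lambda>f. a f + b f)"
    obtain s where s: "s \<in> S" using S(2) by blast
    then have "s \<in> carrier (RP k m)" "\<And>f. f \<in> full_diag k m \<Longrightarrow> s f = b f"
      using S(1) by (auto simp: rp_class_def)
    \<comment> \<open>One element \<open>s\<close> of \<open>S\<close> is enough, since the class of
      \<open>a\<close> absorbs the difference.\<close>
    with c have "(\<lambda>f. c f - s f) \<in> rp_class k m a" by (auto simp: rp_class_def)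
    moreover have "c = (\<lambda>f. (c f - s f) + s f)" by simp
    ultimately show "c \<in> rp_class k m a <+>\<^bsub>RP k m\<^esub> S"
      using s unfolding rp_set_add by blast
  qed
qed

text \<open>Only terms with \<open>f\<close> free of caps reach \<open>h\<close>, by
  \<open>map_comp_full_diagD\<close>. Hence left composition is well defined on cosets.\<close>

lemma rp_comp_full_cong:
  assumes "\<And>f. f \<in> full_diag k m \<Longrightarrow> a f = b f" "h \<in> full_diag k n"
  shows "rp_comp k m n x a h = rp_comp k m n x b h"
  unfolding rp_comp_eq using assms map_comp_full_diagD by (intro sum.cong refl) auto

section \<open>Operations of \<open>Vk k\<close> on representatives\<close>

lemma Vk_carrier: "carrier (Vk_space k m) = rp_class k m ` carrier (RP k m)"
proof -
  have "rp_radical k m +>\<^bsub>RP k m\<^esub> a = rp_class k m a" if "a \<in> carrier (RP k m)" for a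
    using rp_class_add[of "{a}" k m a "\<lambda>f. 0"] that
    by (simp add: a_r_coset_def r_coset_eq_set_mult set_add_def rp_radical_eq rp_class_self)
  then show ?thesis
    by (auto simp: Vk_space_def A_RCOSETS_def RCOSETS_def a_r_coset_def)
qed

lemma Vk_zero: "\<zero>\<^bsub>Vk_space k m\<^esub> = rp_class k m (\<lambda>f. 0)"
  by (simp add: Vk_space_def rp_radical_eq)

lemma Vk_add:
  assumes "a \<in> carrier (RP k m)" "b \<in> carrier (RP k m)"
  shows "rp_class k m a \<oplus>\<^bsub>Vk_space k m\<^esub> rp_class k m b = rp_class k m (\<lambda>f. a f + b f)"
proof -
  have "rp_class k m b \<noteq> {}" using rp_class_self[OF assms(2)] by blast
  from rp_class_add[OF order_refl this assms(1)] show ?thesis by (simp add: Vk_space_def)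
qed

lemma Vk_smult:
  assumes a: "a \<in> carrier (RP k m)"
  shows "c \<odot>\<^bsub>Vk_space k m\<^esub> rp_class k m a = rp_class k m (\<lambda>f. c * a f)"
proof -
  have "(\<lambda>b f. c * b f) ` rp_class k m a \<subseteq> rp_class k m (\<lambda>f. c * a f)"
    by (auto simp: rp_class_def)
  moreover have "rp_class k m a \<noteq> {}" using rp_class_self[OF a] by blast
  ultimately show ?thesis
    using rp_class_add[OF _ _ RP_closed(1)] by (simp add: Vk_space_def rp_radical_eq)
qed

text \<open>By \<open>rp_form_eq\<close> the form takes one value on all representatives, so
  \<open>the_elem\<close> is applied to a singleton.\<close>

lemma Vk_hinner:
  assumes a: "a \<in> carrier (RP k m)" and b: "b \<in> carrier (RP k m)"
  shows "hinner (Vk_space k m) (rp_class k m a) (rp_class k m b) = rp_form k m a b"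
proof -
  have "(\<lambda>(a, b). rp_form k m a b) ` (rp_class k m a \<times> rp_class k m b) = {rp_form k m a b}"
    using rp_class_self[OF a] rp_class_self[OF b] a b
    by (force simp: rp_class_def rp_form_eq image_iff)
  then show ?thesis by (simp add: Vk_space_def)
qed

lemma Vk_act:
  assumes a: "a \<in> carrier (RP k m)"
  shows "act (Vk k) m n x (rp_class k m a) = rp_class k n (rp_comp k m n x a)"
proof -
  have "rp_comp k m n x ` rp_class k m a \<subseteq> rp_class k n (rp_comp k m n x a)"
    using rp_comp_full_cong by (fastforce simp: rp_class_def)
  moreover have "rp_class k m a \<noteq> {}" using rp_class_self[OF a] by blast
  ultimately show ?thesis
    using rp_class_add[OF _ _ RP_closed(1)] by (simp add: Vk_def rp_radical_eq)
qed

lemma obj_Vk [simp]: "obj (Vk k) = Vk_space k"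
  by (simp add: Vk_def)

lemma vectorspace_Vk: "vectorspace class_ring (Vk_space k m)"
proof (rule vs_criteria)
  show "\<forall>v\<in>carrier (Vk_space k m). \<exists>w\<in>carrier (Vk_space k m). v \<oplus>\<^bsub>Vk_space k m\<^esub> w = \<zero>\<^bsub>Vk_space k m\<^esub>"
  proof (clarsimp simp: Vk_carrier)
    fix a assume a: "a \<in> carrier (RP k m)"
    then have "rp_class k m a \<oplus>\<^bsub>Vk_space k m\<^esub> rp_class k m (\<lambda>f. - a f) = \<zero>\<^bsub>Vk_space k m\<^esub>"
      by (simp add: Vk_add Vk_zero)
    then show "\<exists>b\<in>carrier (RP k m).
        rp_class k m a \<oplus>\<^bsub>Vk_space k m\<^esub> rp_class k m b = \<zero>\<^bsub>Vk_space k m\<^esub>"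
      using RP_closed(5)[OF a] by blast
  qed
qed (auto simp: Vk_carrier Vk_zero Vk_add Vk_smult class_field algebra_simps)

text \<open>The classes of the finitely many diagrams span the quotient.\<close>

lemma fin_dim_Vk: "vectorspace.fin_dim class_ring (Vk_space k m)"
proof -
  interpret vectorspace "class_ring :: complex ring" "Vk_space k m" by (rule vectorspace_Vk)
  let ?A = "(\<lambda>f. rp_class k m (rp_basis f)) ` rp_diag k m"
  have A: "?A \<subseteq> carrier (Vk_space k m)" by (auto simp: Vk_carrier rp_basis_closed)
  interpret span: submodule "class_ring :: complex ring" "span ?A" "Vk_space k m"
    by (rule span_is_submodule[OF A])
  have "rp_class k m a \<in> span ?A" if "a \<in> carrier (RP k m)" for a
    using that
  proof (induction rule: RP_induct)
    case zero
    then show ?case using span.zero_closed by (simp add: Vk_zero)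
  next
    case (basis f)
    then show ?case using in_own_span[OF A] by blast
  next
    case (add y z)
    then show ?case using span.m_closed by (simp flip: Vk_add)
  next
    case (smult c y)
    then show ?case using span.smult_closed by (simp flip: Vk_smult)
  qed
  then have "span ?A = carrier (Vk_space k m)"
    using span.subset by (auto simp: Vk_carrier)
  then show ?thesis unfolding fin_dim_def by (intro exI[of _ ?A] conjI A finite_imageI finite_rp_diag)
qed

text \<open>A nonzero class has a nonzero coefficient at some diagram without caps, and its squared
  norm is the sum of the squared moduli of these coefficients.\<close>

lemma Vk_hilbert: "fd_hilbert_space (Vk_space k m)"
proof (intro fd_hilbert_space.intro fd_hilbert_space_axioms.intro vectorspace_Vk fin_dim_Vk)
  fix v assume v: "v \<in> carrier (Vk_space k m)" "v \<noteq> \<zero>\<^bsub>Vk_space k m\<^esub>"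
  then obtain a where a: "a \<in> carrier (RP k m)" "v = rp_class k m a" by (auto simp: Vk_carrier)
  with v have "\<not> (\<forall>f\<in>full_diag k m. a f = 0)" by (simp add: Vk_zero rp_class_eq_iff)
  then obtain f where f: "f \<in> full_diag k m" "a f \<noteq> 0" by blast
  have "Re (hinner (Vk_space k m) v v) = (\<Sum>f\<in>full_diag k m. (cmod (a f))\<^sup>2)"
    using a by (simp add: Vk_hinner rp_form_eq complex_norm_square[symmetric] del: of_real_power)
  also have "\<dots> > 0" using f by (intro sum_pos2[of _ f]) auto
  finally show "0 < Re (hinner (Vk_space k m) v v)" .
qed (auto simp: Vk_carrier Vk_add Vk_smult Vk_hinner rp_form_eq algebra_simps sum.distrib
    sum_distrib_left)

lemma linear_mapI:
  assumes "vectorspace K V" "vectorspace K W" "\<And>v. v \<in> carrier V \<Longrightarrow> T v \<in> carrier W"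
    and "\<And>v w. \<lbrakk>v \<in> carrier V; w \<in> carrier V\<rbrakk> \<Longrightarrow> T (v \<oplus>\<^bsub>V\<^esub> w) = T v \<oplus>\<^bsub>W\<^esub> T w"
    and "\<And>c v. \<lbrakk>c \<in> carrier K; v \<in> carrier V\<rbrakk> \<Longrightarrow> T (c \<odot>\<^bsub>V\<^esub> v) = c \<odot>\<^bsub>W\<^esub> T v"
  shows "linear_map K V W T"
  using assms
  by (auto simp: linear_map_def mod_hom_def mod_hom_axioms_def LinearCombinations.module_hom_def vectorspace_def)

lemma Vk_module: "hilbert_rp_module (Vk k)"
proof (rule hilbert_rp_module.intro)
  fix m n x assume "x \<in> carrier (RP m n)"
  show "linear_map class_ring (obj (Vk k) m) (obj (Vk k) n) (act (Vk k) m n x)"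
    by (rule linear_mapI)
      (auto simp: vectorspace_Vk Vk_carrier Vk_act Vk_add Vk_smult rp_comp_linear)
qed (auto simp: Vk_hilbert Vk_carrier Vk_act Vk_add Vk_smult Vk_hinner rp_id_comp rp_comp_assoc
    rp_comp_linear rp_form_adjoint)

section \<open>Weight and irreducibility of \<open>Vk k\<close>\<close>

lemma Vk_trivial_iff: "carrier (obj (Vk k) m) = {\<zero>\<^bsub>obj (Vk k) m\<^esub>} \<longleftrightarrow> m < k"
proof
  assume "m < k"
  then show "carrier (obj (Vk k) m) = {\<zero>\<^bsub>obj (Vk k) m\<^esub>}"
    using RP_closed(1) by (auto simp: Vk_carrier Vk_zero rp_class_def full_diag_empty)
next
  assume eq: "carrier (obj (Vk k) m) = {\<zero>\<^bsub>obj (Vk k) m\<^esub>}"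
  show "m < k"
  proof (rule ccontr)
    assume "\<not> m < k"
    \<comment> \<open>Read as a diagram from \<open>[k]\<close> to \<open>[m]\<close>,
      \<open>dg_id k\<close> has \<open>k\<close> vertical strings and \<open>m - k\<close> cups on
      the right.\<close>
    then have "dg_id k \<in> full_diag k m" by (simp add: dg_id_full_diag)
    moreover from this have b: "rp_basis (dg_id k) \<in> carrier (RP k m)"
      by (intro rp_basis_closed full_diagD)
    with eq have "rp_class k m (rp_basis (dg_id k)) = rp_class k m (\<lambda>f. 0)"
      by (auto simp: Vk_carrier Vk_zero)
    then have "\<forall>f\<in>full_diag k m. rp_basis (dg_id k) f = 0"
      by (simp only: rp_class_eq_iff[OF b])
    ultimately show False by (auto simp: rp_basis_def)
  qed
qed

lemma Vk_weight: "rp_weight (Vk k) = k"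
  unfolding rp_weight_def by (rule Least_equality) (simp_all add: Vk_trivial_iff del: obj_Vk)

lemma Vk_irreducible: "rp_irreducible (Vk k)"
  unfolding rp_irreducible_def
proof (intro conjI allI impI)
  show "\<exists>n. carrier (obj (Vk k) n) \<noteq> {\<zero>\<^bsub>obj (Vk k) n\<^esub>}"
    by (rule exI[of _ k]) (simp add: Vk_trivial_iff del: obj_Vk)
next
  fix W assume W: "rp_submodule (Vk k) W"
  then have submod: "submodule (class_ring :: complex ring) (W n) (Vk_space k n)" for n
    by (auto simp: rp_submodule_def VectorSpace.subspace_def)
  have act: "act (Vk k) m n x v \<in> W n" if "x \<in> carrier (RP m n)" "v \<in> W m" for m n x v
    using W that by (auto simp: rp_submodule_def)
  have zero: "\<zero>\<^bsub>Vk_space k n\<^esub> \<in> W n" and sub: "W n \<subseteq> carrier (Vk_space k n)" for n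
    using submodule.zero_closed[OF submod] submodule.subset[OF submod] by auto
  show "(\<forall>n. W n = {\<zero>\<^bsub>obj (Vk k) n\<^esub>}) \<or> (\<forall>n. W n = carrier (obj (Vk k) n))"
  proof (rule disjCI)
    assume "\<not> (\<forall>n. W n = carrier (obj (Vk k) n))"
    show "\<forall>n. W n = {\<zero>\<^bsub>obj (Vk k) n\<^esub>}"
    proof (rule ccontr)
      assume "\<not> (\<forall>n. W n = {\<zero>\<^bsub>obj (Vk k) n\<^esub>})"
      then obtain m v where v: "v \<in> W m" "v \<noteq> \<zero>\<^bsub>Vk_space k m\<^esub>" using zero by fastforce
      then obtain a where a: "a \<in> carrier (RP k m)" "v = rp_class k m a"
        using sub by (auto simp: Vk_carrier)
      with v have "\<not> (\<forall>f\<in>full_diag k m. a f = 0)" by (simp add: Vk_zero rp_class_eq_iff)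
      then obtain f where f: "f \<in> full_diag k m" "a f \<noteq> 0" by blast
      \<comment> \<open>Composing with the adjoint of \<open>f\<close> moves the coefficient
        \<open>a f\<close> to the identity diagram.\<close>
      let ?s = "rp_comp k m k (rp_star k m (rp_basis f)) a"
      have "?s (dg_id k) = a f"
        using rp_form_basis[OF a(1) f(1)] by (simp add: rp_form_def rp_tr_eq)
      moreover have "rp_class k k ?s \<in> W k"
        using act[OF rp_star_closed v(1)] a by (simp add: Vk_act)
      then have "inverse (a f) \<odot>\<^bsub>Vk_space k k\<^esub> rp_class k k ?s \<in> W k"
        using submodule.smult_closed[OF submod[of k], of "inverse (a f)"] by simp
      then have "rp_class k k (\<lambda>h. inverse (a f) * ?s h) \<in> W k" by (simp add: Vk_smult)
      \<comment> \<open>A class in degree \<open>k\<close> is determined by its coefficient at the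
        identity, which the scaling has made 1.\<close>
      ultimately have "rp_class k k (rp_id k) \<in> W k"
        using rp_class_eq_iff[OF rp_id_closed, of k "\<lambda>h. inverse (a f) * ?s h"] f(2)
        by (simp add: full_diag_self rp_id_def rp_basis_def)
      then have "rp_class k n b \<in> W n" if "b \<in> carrier (RP k n)" for n b
        using act[OF that] that by (fastforce simp: Vk_act rp_comp_id)
      then have "W n = carrier (Vk_space k n)" for n using sub[of n] by (auto simp: Vk_carrier)
      with \<open>\<not> (\<forall>n. W n = carrier (obj (Vk k) n))\<close> show False by simp
    qed
  qed
qed

section \<open>Uniqueness\<close>

context hilbert_rp_module
begin

lemma vectorspace_obj: "vectorspace class_ring (obj V n)"
  using hilbert by (rule fd_hilbert_space.axioms)

lemma act_mod_hom: "x \<in> carrier (RP m n) \<Longrightarrow> mod_hom class_ring (obj V m) (obj V n) (act V m n x)"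
  using act_linear by (rule linear_map.axioms)

lemma act_closed:
  "\<lbrakk>x \<in> carrier (RP m n); v \<in> carrier (obj V m)\<rbrakk> \<Longrightarrow> act V m n x v \<in> carrier (obj V n)"
  using mod_hom.f_im[OF act_mod_hom] .

lemma act_zero_right:
  "x \<in> carrier (RP m n) \<Longrightarrow> act V m n x \<zero>\<^bsub>obj V m\<^esub> = \<zero>\<^bsub>obj V n\<^esub>"
  using mod_hom.f0_is_0[OF act_mod_hom] .

lemma act_zero_left:
  assumes v: "v \<in> carrier (obj V m)"
  shows "act V m n (\<lambda>f. 0) v = \<zero>\<^bsub>obj V n\<^esub>"
proof -
  interpret vectorspace "class_ring :: complex ring" "obj V n" by (rule vectorspace_obj)
  have "act V m n (0 \<odot>\<^bsub>RP m n\<^esub> (\<lambda>f. 0)) v = 0 \<odot>\<^bsub>obj V n\<^esub> act V m n (\<lambda>f. 0) v"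
    by (rule act_smult[OF RP_closed(1) v])
  then show ?thesis using smult_l_null[OF act_closed[OF RP_closed(1) v]] by simp
qed

text \<open>A diagram with \<open>j < k\<close> through strings factors through \<open>[j]\<close>,
  where the module is zero; linearity extends this to the ideal.\<close>

lemma act_RI:
  assumes low: "\<And>j. j < k \<Longrightarrow> carrier (obj V j) = {\<zero>\<^bsub>obj V j\<^esub>}"
    and v: "v \<in> carrier (obj V k)" and x: "x \<in> RI k"
  shows "act V k k x v = \<zero>\<^bsub>obj V k\<^esub>"
proof -
  interpret vectorspace "class_ring :: complex ring" "obj V k" by (rule vectorspace_obj)
  have "x \<in> carrier (RP k k)" using x by (simp add: RI_def)
  then show ?thesis
  proof (induction rule: RP_induct)
    case zero
    then show ?case by (rule act_zero_left[OF v])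
  next
    case (basis f)
    let ?j = "card (dom f)"
    have j: "?j < k" using x basis by (simp add: RI_def)
    obtain g h where h: "h \<in> rp_diag k ?j" and g: "g \<in> rp_diag ?j k" and f: "f = g \<circ>\<^sub>m h"
      using rp_diag_factor[OF basis(1)] by blast
    note gh = rp_basis_closed[OF g] rp_basis_closed[OF h]
    have "act V k k (rp_basis f) v = act V ?j k (rp_basis g) (act V k ?j (rp_basis h) v)"
      using act_comp[OF gh(2,1) v] rp_comp_basis[OF h g] f by simp
    also have "act V k ?j (rp_basis h) v = \<zero>\<^bsub>obj V ?j\<^esub>"
      using act_closed[OF gh(2) v] low[OF j] by simp
    finally show ?case by (simp add: act_zero_right[OF gh(1)])
  next
    case (add y z)
    then show ?case using act_add[OF _ _ v, of y k z] by simp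
  next
    case (smult c y)
    then show ?case using act_smult[OF _ v, of y k c] smult_r_null[of c] by simp
  qed
qed

text \<open>Modulo \<open>RI k\<close>, which acts as zero, \<open>x\<close> is a multiple of the
  identity.\<close>

lemma act_lowest:
  assumes low: "\<And>j. j < k \<Longrightarrow> carrier (obj V j) = {\<zero>\<^bsub>obj V j\<^esub>}"
    and v: "v \<in> carrier (obj V k)" and x: "x \<in> carrier (RP k k)"
  shows "act V k k x v = x (dg_id k) \<odot>\<^bsub>obj V k\<^esub> v"
proof -
  interpret vectorspace "class_ring :: complex ring" "obj V k" by (rule vectorspace_obj)
  let ?c = "x (dg_id k)"
  let ?p = "\<lambda>f. ?c * rp_id k f" and ?r = "\<lambda>f. x f - ?c * rp_id k f"
  have pr: "?p \<in> carrier (RP k k)" "?r \<in> carrier (RP k k)"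
    by (intro RP_closed rp_id_closed x)+
  have "?r \<in> RI k" using pr(2) by (simp add: RI_eq rp_id_def rp_basis_def)
  then have "act V k k ?r v = \<zero>\<^bsub>obj V k\<^esub>" using act_RI[OF low v] by blast
  moreover have "act V k k ?p v = ?c \<odot>\<^bsub>obj V k\<^esub> v"
    using act_smult[OF rp_id_closed v] act_id[OF v] by simp
  ultimately show ?thesis using act_add[OF pr v] v by simp
qed

section \<open>Inner products of vectors generated in lowest degree\<close>

lemma hinner_smult_right:
  assumes "v \<in> carrier (obj V n)" "w \<in> carrier (obj V n)"
  shows "hinner (obj V n) v (c \<odot>\<^bsub>obj V n\<^esub> w) = cnj c * hinner (obj V n) v w"
proof -
  interpret fd_hilbert_space "obj V n" by (rule hilbert)
  have "hinner (obj V n) v (c \<odot>\<^bsub>obj V n\<^esub> w) = cnj (hinner (obj V n) (c \<odot>\<^bsub>obj V n\<^esub> w) v)"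
    using assms by (intro hinner_cnj smult_closed) auto
  then show ?thesis using assms hinner_smult[of w v c] hinner_cnj[of w v] by simp
qed

lemma ex_unit_vector:
  assumes "carrier (obj V n) \<noteq> {\<zero>\<^bsub>obj V n\<^esub>}"
  obtains v where "v \<in> carrier (obj V n)" "hinner (obj V n) v v = 1"
proof -
  interpret fd_hilbert_space "obj V n" by (rule hilbert)
  let ?i = "hinner (obj V n)"
  obtain w where w: "w \<in> carrier (obj V n)" "w \<noteq> \<zero>\<^bsub>obj V n\<^esub>"
    using assms zero_closed by blast
  define r where "r = Re (?i w w)"
  have r: "r > 0" using hinner_pos[OF w] by (simp add: r_def)
  \<comment> \<open>The value is its own conjugate, hence real.\<close>
  have "?i w w = complex_of_real r"
    using hinner_cnj[OF w(1) w(1)] by (simp add: r_def complex_eq_iff)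
  moreover define c where "c = complex_of_real (1 / sqrt r)"
  have cw: "c \<odot>\<^bsub>obj V n\<^esub> w \<in> carrier (obj V n)" using w by (intro smult_closed) auto
  have "?i (c \<odot>\<^bsub>obj V n\<^esub> w) (c \<odot>\<^bsub>obj V n\<^esub> w) = c * cnj c * ?i w w"
    using w cw by (simp add: hinner_smult hinner_smult_right)
  ultimately have "?i (c \<odot>\<^bsub>obj V n\<^esub> w) (c \<odot>\<^bsub>obj V n\<^esub> w) = complex_of_real (1 / sqrt r * (1 / sqrt r) * r)"
    by (simp only: c_def complex_cnj_complex_of_real of_real_mult)
  also have "1 / sqrt r * (1 / sqrt r) * r = 1" using r by (simp add: field_simps)
  finally show ?thesis using that[OF cw] by simp
qed

text \<open>Moving \<open>a\<close> across the inner product leaves an element of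
  \<open>RP k k\<close>, which acts on \<open>v\<close> by a scalar. Conjugate linearity in the
  second argument and Hermitian symmetry of the form cancel the two conjugations.\<close>

lemma hinner_act:
  assumes low: "\<And>j. j < k \<Longrightarrow> carrier (obj V j) = {\<zero>\<^bsub>obj V j\<^esub>}"
    and v: "v \<in> carrier (obj V k)" and unit: "hinner (obj V k) v v = 1"
    and a: "a \<in> carrier (RP k m)" and b: "b \<in> carrier (RP k m)"
  shows "hinner (obj V m) (act V k m a v) (act V k m b v) = rp_form k m a b"
proof -
  let ?s = "rp_star k m a"
  have "hinner (obj V m) (act V k m a v) (act V k m b v) =
      hinner (obj V k) v (act V k k (rp_comp k m k ?s b) v)"
    using act_star[OF a v act_closed[OF b v]] act_comp[OF b rp_star_closed v] by simp
  also have "\<dots> = cnj (rp_comp k m k ?s b (dg_id k))"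
    using act_lowest[OF low v rp_comp_closed] hinner_smult_right[OF v v] unit by simp
  also have "\<dots> = cnj (rp_form k m b a)" by (simp add: rp_form_def rp_tr_eq)
  also have "\<dots> = rp_form k m a b" using a b by (simp add: rp_form_eq mult.commute)
  finally show ?thesis .
qed

text \<open>Inner products with the images of \<open>v\<close> under diagrams recover the
  coefficients. Conversely, a difference that vanishes on \<open>full_diag k m\<close> sends
  \<open>v\<close> to a vector of norm zero. So the fibres of the map are the cosets of the
  radical.\<close>

lemma act_eq_iff:
  assumes low: "\<And>j. j < k \<Longrightarrow> carrier (obj V j) = {\<zero>\<^bsub>obj V j\<^esub>}"
    and v: "v \<in> carrier (obj V k)" and unit: "hinner (obj V k) v v = 1"
    and a: "a \<in> carrier (RP k m)" and b: "b \<in> carrier (RP k m)"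
  shows "act V k m a v = act V k m b v \<longleftrightarrow> (\<forall>f\<in>full_diag k m. a f = b f)"
proof
  assume eq: "act V k m a v = act V k m b v"
  show "\<forall>f\<in>full_diag k m. a f = b f"
  proof
    fix f assume f: "f \<in> full_diag k m"
    then have "rp_basis f \<in> carrier (RP k m)" by (intro rp_basis_closed full_diagD)
    from hinner_act[OF low v unit a this] hinner_act[OF low v unit b this] eq
    show "a f = b f" using rp_form_basis[OF a f] rp_form_basis[OF b f] by simp
  qed
next
  assume eq: "\<forall>f\<in>full_diag k m. a f = b f"
  interpret fd_hilbert_space "obj V m" by (rule hilbert)
  let ?d = "\<lambda>f. a f - b f"
  have d: "?d \<in> carrier (RP k m)" by (intro RP_closed a b)
  have "hinner (obj V m) (act V k m ?d v) (act V k m ?d v) = 0"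
    using hinner_act[OF low v unit d d] eq by (simp add: rp_form_eq[OF d d])
  then have "act V k m ?d v = \<zero>\<^bsub>obj V m\<^esub>" using hinner_pos[OF act_closed[OF d v]] by fastforce
  then show "act V k m a v = act V k m b v"
    using act_add[OF d b v] act_closed[OF b v] by simp
qed

text \<open>This is the cyclic submodule generated by \<open>v\<close>; irreducibility will identify
  it with zero or with \<open>V\<close>.\<close>

lemma rp_submodule_generated:
  assumes v: "v \<in> carrier (obj V k)"
  shows "rp_submodule V (\<lambda>n. (\<lambda>a. act V k n a v) ` carrier (RP k n))"
  unfolding rp_submodule_def
proof (intro conjI allI ballI)
  fix n
  interpret vectorspace "class_ring :: complex ring" "obj V n" by (rule vectorspace_obj)
  show "VectorSpace.subspace class_ring ((\<lambda>a. act V k n a v) ` carrier (RP k n)) (obj V n)"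
  proof (rule VectorSpace.subspace.intro[OF vectorspace_obj], unfold_locales)
    show "(\<lambda>a. act V k n a v) ` carrier (RP k n) \<subseteq> carrier (obj V n)"
      using act_closed v by auto
    show "\<zero>\<^bsub>obj V n\<^esub> \<in> (\<lambda>a. act V k n a v) ` carrier (RP k n)"
      using act_zero_left[OF v, of n] RP_closed(1) by (metis imageI)
  next
    fix w w' assume "w \<in> (\<lambda>a. act V k n a v) ` carrier (RP k n)"
      "w' \<in> (\<lambda>a. act V k n a v) ` carrier (RP k n)"
    then obtain a b where ab: "a \<in> carrier (RP k n)" "b \<in> carrier (RP k n)"
      and w: "w = act V k n a v" "w' = act V k n b v" by blast
    have "w \<oplus>\<^bsub>obj V n\<^esub> w' = act V k n (\<lambda>f. a f + b f) v"
      using act_add[OF ab v] w by simp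
    then show "w \<oplus>\<^bsub>obj V n\<^esub> w' \<in> (\<lambda>a. act V k n a v) ` carrier (RP k n)"
      using RP_closed(2)[OF ab] by blast
  next
    fix c :: complex and w assume "w \<in> (\<lambda>a. act V k n a v) ` carrier (RP k n)"
    then obtain a where a: "a \<in> carrier (RP k n)" and w: "w = act V k n a v" by blast
    have "c \<odot>\<^bsub>obj V n\<^esub> w = act V k n (\<lambda>f. c * a f) v"
      using act_smult[OF a v] w by simp
    then show "c \<odot>\<^bsub>obj V n\<^esub> w \<in> (\<lambda>a. act V k n a v) ` carrier (RP k n)"
      using RP_closed(4)[OF a] by blast
  qed
next
  fix m n x w assume x: "x \<in> carrier (RP m n)" and "w \<in> (\<lambda>a. act V k m a v) ` carrier (RP k m)"
  then obtain a where a: "a \<in> carrier (RP k m)" and w: "w = act V k m a v" by blast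
  have "act V m n x w = act V k n (rp_comp k m n x a) v"
    using act_comp[OF a x v] w by simp
  then show "act V m n x w \<in> (\<lambda>a. act V k n a v) ` carrier (RP k n)"
    using rp_comp_closed by blast
qed

text \<open>A unit vector in lowest degree generates \<open>V\<close>, so every property of the map
  to cosets is checked on representatives: linearity and naturality by the module axioms,
  injectivity by \<open>act_eq_iff\<close>, preservation of inner products by
  \<open>hinner_act\<close>.\<close>

lemma rp_isomorphic_Vk:
  assumes irred: "rp_irreducible V" and weight: "rp_weight V = k"
  shows "rp_isomorphic V (Vk k)"
proof -
  let ?P = "\<lambda>n. carrier (obj V n) \<noteq> {\<zero>\<^bsub>obj V n\<^esub>}"
  have ex: "\<exists>n. ?P n" using irred by (simp add: rp_irreducible_def)
  have low: "carrier (obj V j) = {\<zero>\<^bsub>obj V j\<^esub>}" if "j < k" for j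
    using not_less_Least[of j ?P] that weight by (auto simp: rp_weight_def)
  have "?P k" using LeastI_ex[OF ex] weight by (simp add: rp_weight_def)
  then obtain v where v: "v \<in> carrier (obj V k)" and unit: "hinner (obj V k) v v = 1"
    by (rule ex_unit_vector)
  interpret vectorspace "class_ring :: complex ring" "obj V k" by (rule vectorspace_obj)
  \<comment> \<open>Rules out that the cyclic submodule is zero.\<close>
  have "v \<noteq> \<zero>\<^bsub>obj V k\<^esub>"
  proof
    assume "v = \<zero>\<^bsub>obj V k\<^esub>"
    then show False
      using hinner_smult_right[OF v v, of 0] smult_l_null[OF v] unit by simp
  qed
  have gen: "carrier (obj V n) = (\<lambda>a. act V k n a v) ` carrier (RP k n)" for n
  proof -
    let ?W = "\<lambda>n. (\<lambda>a. act V k n a v) ` carrier (RP k n)"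
    have "v \<in> ?W k" using act_id[OF v] rp_id_closed by (metis imageI)
    then have "?W k \<noteq> {\<zero>\<^bsub>obj V k\<^esub>}" using \<open>v \<noteq> \<zero>\<^bsub>obj V k\<^esub>\<close> by blast
    moreover have "(\<forall>n. ?W n = {\<zero>\<^bsub>obj V n\<^esub>}) \<or> (\<forall>n. ?W n = carrier (obj V n))"
      using irred rp_submodule_generated[OF v] unfolding rp_irreducible_def by blast
    ultimately show ?thesis by metis
  qed
  \<comment> \<open>the inverse of the isometry: a coset is the fibre of \<open>a \<mapsto> av\<close>\<close>
  define U where "U = (\<lambda>n w. {a \<in> carrier (RP k n). act V k n a v = w})"
  have U: "U n (act V k n a v) = rp_class k n a" if "a \<in> carrier (RP k n)" for n a
    using act_eq_iff[OF low v unit _ that] by (auto simp: U_def rp_class_def)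
  have "linear_map class_ring (obj V n) (obj (Vk k) n) (U n)" for n
  proof (rule linear_mapI)
    fix w w' assume "w \<in> carrier (obj V n)" "w' \<in> carrier (obj V n)"
    then obtain a b where ab: "a \<in> carrier (RP k n)" "b \<in> carrier (RP k n)"
      and w: "w = act V k n a v" "w' = act V k n b v" by (auto simp: gen)
    then show "U n (w \<oplus>\<^bsub>obj V n\<^esub> w') = U n w \<oplus>\<^bsub>obj (Vk k) n\<^esub> U n w'"
      using act_add[OF ab v] U[OF RP_closed(2)[OF ab]] by (simp add: U Vk_add)
  next
    fix c :: complex and w assume "w \<in> carrier (obj V n)"
    then obtain a where a: "a \<in> carrier (RP k n)" and w: "w = act V k n a v" by (auto simp: gen)
    then show "U n (c \<odot>\<^bsub>obj V n\<^esub> w) = c \<odot>\<^bsub>obj (Vk k) n\<^esub> U n w"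
      using act_smult[OF a v, of c] U[OF RP_closed(4)[OF a], of c] by (simp add: U Vk_smult)
  qed (auto simp: vectorspace_obj vectorspace_Vk gen U Vk_carrier)
  moreover have "bij_betw (U n) (carrier (obj V n)) (carrier (obj (Vk k) n))" for n
  proof -
    have "inj_on (U n) (carrier (obj V n))"
      by (rule inj_onI) (auto simp: gen U rp_class_eq_iff act_eq_iff[OF low v unit])
    moreover have "U n ` carrier (obj V n) = carrier (obj (Vk k) n)"
      by (simp add: gen Vk_carrier image_image U)
    ultimately show ?thesis by (simp add: bij_betw_def)
  qed
  moreover have "hinner (obj (Vk k) n) (U n w) (U n w') = hinner (obj V n) w w'"
    if "w \<in> carrier (obj V n)" "w' \<in> carrier (obj V n)" for n w w'
    using that by (auto simp: gen U Vk_hinner hinner_act[OF low v unit])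
  moreover have "U n (act V m n x w) = act (Vk k) m n x (U m w)"
    if x: "x \<in> carrier (RP m n)" and w: "w \<in> carrier (obj V m)" for m n x w
  proof -
    obtain a where a: "a \<in> carrier (RP k m)" "w = act V k m a v" using w by (auto simp: gen)
    then show ?thesis
      using act_comp[OF a(1) x v] U[of "rp_comp k m n x a" n] by (simp add: U Vk_act)
  qed
  ultimately show ?thesis unfolding rp_isomorphic_def by (intro exI[of _ U]) blast
qed

end

text \<open>The type variable \<open>'a\<close> is arbitrary, so uniqueness covers modules with
  carriers in any type.\<close>

theorem proposition4p41:
  fixes k :: nat
  shows "hilbert_rp_module (Vk k) \<and> rp_irreducible (Vk k) \<and> rp_weight (Vk k) = k \<and>
         (\<forall>W :: 'a rp_functor.
            hilbert_rp_module W \<and> rp_irreducible W \<and> rp_weight W = k \<longrightarrow> rp_isomorphic W (Vk k))"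
  using Vk_module Vk_irreducible Vk_weight hilbert_rp_module.rp_isomorphic_Vk by blast

end
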